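(* Let $(S,+,\circ)$ be a weak brace, and for $b\in S$ let $\rho_b:S\to S$, $\rho_b(a)=(a^-+b)^-\circ b$. Then the map $\rho:S\to\mathcal{T}_S$, $b\mapsto\rho_b$, is a semigroup anti-homomorphism of the inverse semigroup $(S,\circ)$ into the monoid $\mathcal{T}_S$, i.e. $\rho_{b\circ c}=\rho_c\rho_b$ for all $b,c\in S$.
   Context: A semigroup is inverse if each element $a$ has a unique inverse, i.e. a unique $x$ with $axa=a$ and $xax=x$. A weak (left) brace is a non-empty set $S$ with two binary operations $+$ and $\circ$ such that $(S,+)$ and $(S,\circ)$ are both inverse semigroups (not necessarily commutative) and, for all $a,b,c\in S$, $a\circ(b+c)=a\circ b-a+a\circ c$ and $a\circ a^-=-a+a$, where $-a$ is the inverse of $a$ in $(S,+)$, $a^-$ is the inverse of $a$ in $(S,\circ)$, and $\circ$ has higher precedence than $+$. $\mathcal{T}_S$ denotes the full transformation monoid of all maps $S\to S$ under composition, $(\rho_c\rho_b)(a)=\rho_c(\rho_b(a))$. *)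

theory Defs
  imports "HOL-Library.FuncSet"
begin

locale semigroup_on =
  fixes S :: "'a set" and mul :: "'a \<Rightarrow> 'a \<Rightarrow> 'a" (infixl "\<cdot>" 70)
  assumes closed: "a \<in> S \<Longrightarrow> b \<in> S \<Longrightarrow> a \<cdot> b \<in> S"
    and assoc: "a \<in> S \<Longrightarrow> b \<in> S \<Longrightarrow> c \<in> S \<Longrightarrow> (a \<cdot> b) \<cdot> c = a \<cdot> (b \<cdot> c)"

definition is_inverse_of :: "('a \<Rightarrow> 'a \<Rightarrow> 'a) \<Rightarrow> 'a \<Rightarrow> 'a \<Rightarrow> bool" where
  "is_inverse_of mul x a \<longleftrightarrow> mul (mul a x) a = a \<and> mul (mul x a) x = x"

locale inverse_semigroup_on = semigroup_on +
  assumes ex1_inverse: "a \<in> S \<Longrightarrow> \<exists>!x. x \<in> S \<and> is_inverse_of mul x a"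

text \<open>Only meaningful for \<open>a \<in> S\<close> in an inverse semigroup, where the description is unique.\<close>

definition inverse_on :: "'a set \<Rightarrow> ('a \<Rightarrow> 'a \<Rightarrow> 'a) \<Rightarrow> 'a \<Rightarrow> 'a" where
  "inverse_on S mul a = (THE x. x \<in> S \<and> is_inverse_of mul x a)"

locale weak_brace =
  add: inverse_semigroup_on S add + circ: inverse_semigroup_on S circ
  for S :: "'a set"
    and add :: "'a \<Rightarrow> 'a \<Rightarrow> 'a" (infixl "\<oplus>" 65)
    and circ :: "'a \<Rightarrow> 'a \<Rightarrow> 'a" (infixl "\<odot>" 70) +
  assumes nonempty: "S \<noteq> {}"
    and left_distrib: "a \<in> S \<Longrightarrow> b \<in> S \<Longrightarrow> c \<in> S \<Longrightarrow>
      a \<odot> (b \<oplus> c) = a \<odot> b \<oplus> inverse_on S add a \<oplus> a \<odot> c"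
    and circ_inverse: "a \<in> S \<Longrightarrow>
      a \<odot> inverse_on S circ a = inverse_on S add a \<oplus> a"

text \<open>
  A self-map of \<open>S\<close> is represented by the HOL function that is \<open>undefined\<close> outside \<open>S\<close>, so
  equality of self-maps is equality of HOL functions. The full transformation monoid of \<open>S\<close> has
  carrier \<open>S \<rightarrow>\<^sub>E S\<close> and multiplication \<open>compose S\<close>, where
  \<open>compose S g f\<close> applies \<open>f\<close> first. The map \<open>\<rho>\<^sub>b\<close> is restricted to \<open>S\<close> accordingly.
\<close>

abbreviation full_transformations :: "'a set \<Rightarrow> ('a \<Rightarrow> 'a) set" where
  "full_transformations S \<equiv> S \<rightarrow>\<^sub>E S"

definition brace_rho ::
    "'a set \<Rightarrow> ('a \<Rightarrow> 'a \<Rightarrow> 'a) \<Rightarrow> ('a \<Rightarrow> 'a \<Rightarrow> 'a) \<Rightarrow> 'a \<Rightarrow> 'a \<Rightarrow> 'a" where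
  "brace_rho S add circ b =
    (\<lambda>a\<in>S. circ (inverse_on S circ (add (inverse_on S circ a) b)) b)"

locale semigroup_anti_hom =
  source: semigroup_on A f + target: semigroup_on B g
  for A :: "'a set" and f :: "'a \<Rightarrow> 'a \<Rightarrow> 'a"
    and B :: "'b set" and g :: "'b \<Rightarrow> 'b \<Rightarrow> 'b" +
  fixes h :: "'a \<Rightarrow> 'b"
  assumes maps_to: "h \<in> A \<rightarrow> B"
    and anti_mult: "x \<in> A \<Longrightarrow> y \<in> A \<Longrightarrow> h (f x y) = g (h y) (h x)"

end

theory Submission
  imports Defs
begin

text \<open>
  Write \<open>-a\<close> and \<open>a\<^sup>-\<close> for the inverses of \<open>a\<close> in \<open>(S,+)\<close> and \<open>(S,\<circ>)\<close>. Inverses reverse products, so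
  \<open>\<rho>\<^sub>b(a)\<^sup>- = b\<^sup>- \<circ> (a\<^sup>- + b)\<close>, and everything reduces to the identity
  \<open>b\<^sup>- \<circ> (x + b) + c = b\<^sup>- \<circ> (x + b \<circ> c)\<close> for \<open>x = a\<^sup>-\<close>: inverting both sides and multiplying
  by \<open>c\<close> on the right gives \<open>\<rho>\<^sub>c(\<rho>\<^sub>b(a))\<close> and \<open>\<rho>\<^bsub>b \<circ> c\<^esub>(a)\<close> respectively.
  Left distributivity expands the two sides to \<open>b\<^sup>- \<circ> x - b\<^sup>- + e + c\<close> and
  \<open>b\<^sup>- \<circ> x - b\<^sup>- + e \<circ> c\<close>, where \<open>e = b\<^sup>- \<circ> b\<close> is idempotent. Hence the heart of the matter
  is that \<open>e \<circ> c = e + c\<close> for every idempotent \<open>e\<close> (lemma \<open>idem_circ_eq_add\<close>).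

  To see this, note that the axiom \<open>a \<circ> a\<^sup>- = -a + a\<close> makes the additive and the multiplicative
  idempotents coincide. The two operations then agree on idempotents, so that an idempotent \<open>e\<close>
  acts on \<open>(S,+)\<close> by an endomorphism \<open>c \<mapsto> e \<circ> c\<close>. Applied to \<open>e = -b + b\<close>, which fixes \<open>b\<close>,
  this yields \<open>b - b = -b + b\<close>: the additive semigroup is Clifford. Consequently \<open>e + c\<close> is
  fixed by the idempotent \<open>e + (c - c)\<close>, and expanding that product gives \<open>e \<circ> c\<close>.
\<close>

section \<open>Inverse semigroups on a carrier set\<close>

context inverse_semigroup_on
begin

abbreviation inver :: "'a \<Rightarrow> 'a" where
  "inver \<equiv> inverse_on S mul"

definition idem :: "'a \<Rightarrow> bool" where
  "idem e \<longleftrightarrow> e \<in> S \<and> e \<cdot> e = e"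

lemma inver_spec:
  assumes "a \<in> S"
  shows "inver a \<in> S \<and> is_inverse_of mul (inver a) a"
  unfolding inverse_on_def using theI'[OF ex1_inverse[OF assms]] .

lemma inver_closed [simp]: "a \<in> S \<Longrightarrow> inver a \<in> S"
  using inver_spec by blast

lemma mul_inver_mul: "a \<in> S \<Longrightarrow> a \<cdot> inver a \<cdot> a = a"
  using inver_spec by (simp add: is_inverse_of_def)

lemma inver_mul_inver: "a \<in> S \<Longrightarrow> inver a \<cdot> a \<cdot> inver a = inver a"
  using inver_spec by (simp add: is_inverse_of_def)

lemma inver_unique:
  assumes "a \<in> S" "x \<in> S" "a \<cdot> x \<cdot> a = a" "x \<cdot> a \<cdot> x = x"
  shows "inver a = x"
proof -
  have "is_inverse_of mul x a" using assms by (simp add: is_inverse_of_def)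
  thus ?thesis using ex1_inverse[OF assms(1)] inver_spec[OF assms(1)] assms(2) by blast
qed

lemma inver_inver: "a \<in> S \<Longrightarrow> inver (inver a) = a"
  by (rule inver_unique) (auto simp: mul_inver_mul inver_mul_inver)

lemma inver_idem: "idem e \<Longrightarrow> inver e = e"
  by (rule inver_unique) (auto simp: idem_def)

lemma idem_closed: "idem e \<Longrightarrow> e \<in> S"
  by (simp add: idem_def)

lemma idem_mul_inver: "a \<in> S \<Longrightarrow> idem (a \<cdot> inver a)"
  by (metis assoc closed idem_def inver_closed mul_inver_mul)

lemma idem_inver_mul: "a \<in> S \<Longrightarrow> idem (inver a \<cdot> a)"
  by (metis idem_mul_inver inver_closed inver_inver)

text \<open>
  The inverse \<open>x\<close> of \<open>e \<cdot> f\<close> equals the idempotent \<open>f \<cdot> x \<cdot> e\<close>, because the latter is also an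
  inverse of \<open>e \<cdot> f\<close>. Idempotents are their own inverses, so \<open>e \<cdot> f = x\<close>.
\<close>

lemma idem_mul:
  assumes "idem e" "idem f"
  shows "idem (e \<cdot> f)"
proof -
  have S: "e \<in> S" "f \<in> S" and ee: "e \<cdot> e = e" and ff: "f \<cdot> f = f"
    using assms by (auto simp: idem_def)
  define x where "x = inver (e \<cdot> f)"
  have x: "x \<in> S" by (simp add: x_def S closed)
  have ee': "e \<cdot> (e \<cdot> y) = e \<cdot> y" and ff': "f \<cdot> (f \<cdot> y) = f \<cdot> y" if "y \<in> S" for y
    using that S ee ff by (simp_all flip: assoc)
  have efx: "e \<cdot> (f \<cdot> (x \<cdot> (e \<cdot> f))) = e \<cdot> f"
    using mul_inver_mul[of "e \<cdot> f"] S x by (simp add: x_def[symmetric] assoc closed)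
  have xef: "x \<cdot> (e \<cdot> (f \<cdot> x)) = x"
    using inver_mul_inver[of "e \<cdot> f"] S x by (simp add: x_def[symmetric] assoc closed)
  have xef': "x \<cdot> (e \<cdot> (f \<cdot> (x \<cdot> e))) = x \<cdot> e"
    using arg_cong[OF xef, of "\<lambda>y. y \<cdot> e"] S x by (simp add: assoc closed)
  have "inver (e \<cdot> f) = f \<cdot> x \<cdot> e"
    by (rule inver_unique) (use S x in \<open>simp_all add: assoc closed ee' ff' efx xef'\<close>)
  hence fxe: "x = f \<cdot> x \<cdot> e" by (simp add: x_def)
  have "f \<cdot> x \<cdot> e \<cdot> (f \<cdot> x \<cdot> e) = f \<cdot> x \<cdot> e"
    using S x by (simp add: assoc closed xef')
  hence "idem x" unfolding fxe[symmetric] using x by (simp add: idem_def)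
  moreover have "inver x = e \<cdot> f"
    using inver_inver[of "e \<cdot> f"] S by (simp add: x_def closed)
  ultimately show ?thesis using inver_idem by metis
qed

text \<open>Both \<open>e \<cdot> f\<close> and \<open>f \<cdot> e\<close> are inverses of the idempotent \<open>e \<cdot> f\<close>.\<close>

lemma idem_commute:
  assumes "idem e" "idem f"
  shows "e \<cdot> f = f \<cdot> e"
proof -
  have S: "e \<in> S" "f \<in> S" and ee: "e \<cdot> e = e" and ff: "f \<cdot> f = f"
    using assms by (auto simp: idem_def)
  have ee': "e \<cdot> (e \<cdot> y) = e \<cdot> y" and ff': "f \<cdot> (f \<cdot> y) = f \<cdot> y" if "y \<in> S" for y
    using that S ee ff by (simp_all flip: assoc)
  have ef: "e \<cdot> (f \<cdot> (e \<cdot> f)) = e \<cdot> f" and fe: "f \<cdot> (e \<cdot> (f \<cdot> e)) = f \<cdot> e"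
    using idem_mul[OF assms] idem_mul[OF assms(2,1)] S by (simp_all add: idem_def assoc closed)
  have "inver (e \<cdot> f) = f \<cdot> e"
    by (rule inver_unique) (use S in \<open>simp_all add: assoc closed ee' ff' ef fe\<close>)
  thus ?thesis using inver_idem[OF idem_mul[OF assms]] by simp
qed

lemma idem_sandwich:
  assumes "idem e" "idem f"
  shows "e \<cdot> f \<cdot> e = e \<cdot> f"
proof -
  have "e \<cdot> f \<cdot> e = f \<cdot> (e \<cdot> e)"
    using assms by (simp add: idem_commute[OF assms] assoc idem_closed)
  thus ?thesis using assms(1) by (simp add: idem_commute[OF assms] idem_def)
qed

lemma inver_mul:
  assumes "a \<in> S" "b \<in> S"
  shows "inver (a \<cdot> b) = inver b \<cdot> inver a"
proof -
  let ?e = "inver a \<cdot> a" and ?f = "b \<cdot> inver b"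
  have comm: "?e \<cdot> ?f = ?f \<cdot> ?e"
    using assms by (intro idem_commute idem_inver_mul idem_mul_inver)
  have "a \<cdot> b \<cdot> (inver b \<cdot> inver a) \<cdot> (a \<cdot> b) = a \<cdot> (?f \<cdot> ?e) \<cdot> b"
    using assms by (simp add: assoc closed)
  also have "\<dots> = a \<cdot> inver a \<cdot> a \<cdot> (b \<cdot> inver b \<cdot> b)"
    unfolding comm[symmetric] using assms by (simp add: assoc closed)
  also have "\<dots> = a \<cdot> b" using assms by (simp only: mul_inver_mul)
  finally have 1: "a \<cdot> b \<cdot> (inver b \<cdot> inver a) \<cdot> (a \<cdot> b) = a \<cdot> b" .
  have "inver b \<cdot> inver a \<cdot> (a \<cdot> b) \<cdot> (inver b \<cdot> inver a) = inver b \<cdot> (?e \<cdot> ?f) \<cdot> inver a"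
    using assms by (simp add: assoc closed)
  also have "\<dots> = inver b \<cdot> b \<cdot> inver b \<cdot> (inver a \<cdot> a \<cdot> inver a)"
    unfolding comm using assms by (simp add: assoc closed)
  also have "\<dots> = inver b \<cdot> inver a" using assms by (simp only: inver_mul_inver)
  finally show ?thesis using 1 assms by (intro inver_unique) (simp_all add: closed)
qed

end

section \<open>Idempotents of a weak brace\<close>

context weak_brace
begin

lemma idem_circ_iff_add: "circ.idem e \<longleftrightarrow> add.idem e"
proof
  assume e: "circ.idem e"
  hence "e = add.inver e \<oplus> e"
    using circ_inverse[of e] circ.inver_idem[OF e] by (simp add: circ.idem_def)
  thus "add.idem e" using add.idem_inver_mul[of e] circ.idem_closed[OF e] by metis
next
  assume e: "add.idem e"
  hence "e = e \<odot> circ.inver e"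
    using circ_inverse[of e] add.inver_idem[OF e] by (simp add: add.idem_def)
  thus "circ.idem e" using circ.idem_mul_inver[of e] add.idem_closed[OF e] by metis
qed

lemma idem_distrib:
  assumes "add.idem e" "b \<in> S" "c \<in> S"
  shows "e \<odot> (b \<oplus> c) = e \<odot> b \<oplus> e \<oplus> e \<odot> c"
  using left_distrib[of e b c] assms by (simp add: add.inver_idem add.idem_closed)

text \<open>
  Expanding \<open>e \<odot> (f \<oplus> f)\<close> shows \<open>e \<odot> f \<le> e\<close> in the additive order of idempotents, and likewise
  \<open>e \<odot> f \<le> f\<close>. With \<open>g = e \<oplus> f\<close> the products \<open>g \<odot> e\<close> and \<open>g \<odot> f\<close> both equal \<open>e \<odot> f\<close>, hence
  expanding \<open>g = g \<odot> (e \<oplus> f)\<close> leaves only \<open>e \<odot> f\<close>.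
\<close>

lemma idem_circ_idem:
  assumes e: "add.idem e" and f: "add.idem f"
  shows "e \<odot> f = e \<oplus> f"
proof -
  have below: "u \<odot> v \<oplus> u = u \<odot> v" if "add.idem u" "add.idem v" for u v
  proof -
    let ?p = "u \<odot> v"
    have p: "add.idem ?p"
      using circ.idem_mul[of u v] that by (simp add: idem_circ_iff_add)
    have S: "u \<in> S" "v \<in> S" "?p \<in> S" using that p by (auto simp: add.idem_closed)
    have "?p = u \<odot> (v \<oplus> v)" using that by (simp add: add.idem_def)
    also have "\<dots> = ?p \<oplus> u \<oplus> ?p" by (rule idem_distrib[OF that(1) S(2,2)])
    also have "\<dots> = ?p \<oplus> ?p \<oplus> u"
      using S add.idem_commute[OF that(1) p] by (simp add: add.assoc)
    also have "?p \<oplus> ?p = ?p" using p by (simp add: add.idem_def)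
    finally show ?thesis by (rule sym)
  qed
  define p where "p = e \<odot> f"
  define g where "g = e \<oplus> f"
  have fe: "f \<odot> e = p"
    using circ.idem_commute[of e f] e f by (simp add: idem_circ_iff_add p_def)
  have p: "add.idem p"
    using circ.idem_mul[of e f] e f by (simp add: idem_circ_iff_add p_def)
  have g: "add.idem g" using add.idem_mul[OF e f] by (simp add: g_def)
  have S: "e \<in> S" "f \<in> S" "p \<in> S" "g \<in> S" using e f p g by (auto simp: add.idem_closed)
  have pe: "p \<oplus> e = p" using below[OF e f] by (simp add: p_def)
  have pf: "p \<oplus> f = p" using below[OF f e] fe by simp
  have ep: "e \<oplus> p = p" using add.idem_commute[OF e p] pe by simp
  have eg: "e \<odot> g = p"
    using idem_distrib[OF e S(1,2)] e ep idem_circ_iff_add[of e]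
    by (simp add: g_def p_def add.idem_def circ.idem_def)
  have fg: "f \<odot> g = p"
    using idem_distrib[OF f S(1,2)] f fe pf S idem_circ_iff_add[of f]
    by (simp add: g_def add.idem_def circ.idem_def)
  have "g \<odot> e = p" "g \<odot> f = p"
    using eg fg circ.idem_commute e f g by (metis idem_circ_iff_add)+
  hence "g \<odot> g = p \<oplus> g \<oplus> p"
    using idem_distrib[OF g S(1,2)] by (simp add: g_def)
  also have "\<dots> = p"
    using S pe pf p by (simp add: g_def add.assoc[symmetric] add.idem_def)
  finally have "g = p"
    using g idem_circ_iff_add[of g] by (simp add: circ.idem_def)
  thus ?thesis by (simp add: p_def g_def)
qed

text \<open>
  Writing \<open>b = h \<oplus> b\<close> with \<open>h\<close> the idempotent \<open>b - b\<close>, the product \<open>e \<odot> b\<close> absorbs both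
  \<open>e\<close> and \<open>h\<close> from the left.
\<close>

lemma idem_circ_absorb:
  assumes e: "add.idem e" and b: "b \<in> S"
  shows "e \<oplus> (b \<oplus> add.inver b) \<oplus> e \<odot> b = e \<odot> b" "e \<oplus> e \<odot> b = e \<odot> b"
proof -
  let ?h = "b \<oplus> add.inver b"
  have h: "add.idem ?h" using b by (rule add.idem_mul_inver)
  have S: "e \<in> S" "?h \<in> S" "e \<odot> b \<in> S"
    using e h b by (auto simp: add.idem_closed circ.closed)
  have "e \<odot> b = e \<odot> (?h \<oplus> b)" using b by (simp add: add.mul_inver_mul)
  also have "\<dots> = e \<oplus> ?h \<oplus> e \<oplus> e \<odot> b"
    by (simp only: idem_distrib[OF e S(2) b] idem_circ_idem[OF e h])
  also have "e \<oplus> ?h \<oplus> e = e \<oplus> ?h" by (rule add.idem_sandwich[OF e h])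
  finally show 1: "e \<oplus> ?h \<oplus> e \<odot> b = e \<odot> b" by (rule sym)
  have "e \<oplus> (e \<oplus> ?h \<oplus> e \<odot> b) = e \<oplus> ?h \<oplus> e \<odot> b"
    using S e by (simp add: add.assoc[symmetric] add.closed add.idem_def)
  thus "e \<oplus> e \<odot> b = e \<odot> b" unfolding 1 .
qed

lemma idem_circ_add_hom:
  assumes e: "add.idem e" and b: "b \<in> S" and c: "c \<in> S"
  shows "e \<odot> (b \<oplus> c) = e \<odot> b \<oplus> e \<odot> c"
  using idem_distrib[OF assms] idem_circ_absorb(2)[OF e c] assms
  by (simp add: add.assoc circ.closed add.idem_closed)

text \<open>
  The idempotent \<open>f = -b + b = b \<odot> b\<^sup>-\<close> fixes \<open>b\<close> multiplicatively, so it absorbs into \<open>b\<close>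
  additively as well, that is \<open>b - b \<le> -b + b\<close>. The same for \<open>-b\<close> is the reverse inequality.
\<close>

lemma add_clifford:
  assumes "b \<in> S"
  shows "b \<oplus> add.inver b = add.inver b \<oplus> b"
proof -
  have le: "(add.inver b \<oplus> b) \<oplus> (b \<oplus> add.inver b) = b \<oplus> add.inver b" if b: "b \<in> S" for b
  proof -
    let ?f = "add.inver b \<oplus> b"
    have f: "add.idem ?f" using b by (rule add.idem_inver_mul)
    have "?f \<odot> b = b"
      using circ_inverse[OF b] circ.mul_inver_mul[OF b] by simp
    hence "?f \<oplus> b = b" using idem_circ_absorb(2)[OF f b] by simp
    thus ?thesis using b by (simp add: add.assoc[symmetric] add.closed)
  qed
  have "add.inver b \<oplus> b = (b \<oplus> add.inver b) \<oplus> (add.inver b \<oplus> b)"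
    using le[of "add.inver b"] assms by (simp add: add.inver_inver)
  also have "\<dots> = (add.inver b \<oplus> b) \<oplus> (b \<oplus> add.inver b)"
    using assms by (intro add.idem_commute add.idem_mul_inver add.idem_inver_mul)
  also have "\<dots> = b \<oplus> add.inver b" by (rule le[OF assms])
  finally show ?thesis by (rule sym)
qed

text \<open>
  An element \<open>x = e \<oplus> c\<close> is fixed by \<open>x \<odot> x\<^sup>- = -x + x\<close>, which the Clifford property rewrites
  to \<open>x - x = e \<oplus> (c - c) = e \<odot> (c - c)\<close>. Since \<open>c - c\<close> in turn fixes \<open>c\<close>, distributing this
  idempotent over \<open>e \<oplus> c\<close> leaves \<open>e \<odot> c\<close>.
\<close>

lemma idem_circ_eq_add:
  assumes e: "add.idem e" and c: "c \<in> S"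
  shows "e \<odot> c = e \<oplus> c"
proof -
  define h where "h = c \<oplus> add.inver c"
  define x where "x = e \<oplus> c"
  have h: "add.idem h" unfolding h_def using c by (rule add.idem_mul_inver)
  have S: "e \<in> S" "h \<in> S" "x \<in> S"
    using e h c by (auto simp: add.idem_closed add.closed x_def)
  define k where "k = e \<oplus> h"
  have k: "add.idem k" unfolding k_def by (rule add.idem_mul[OF e h])
  have hc: "h \<odot> c = c"
    using circ_inverse[OF c] circ.mul_inver_mul[OF c] add_clifford[OF c] by (simp add: h_def)
  have "x \<oplus> add.inver x = e \<oplus> h \<oplus> e"
    using S c e by (simp add: x_def h_def add.inver_mul add.inver_idem add.assoc add.closed)
  also have "\<dots> = k" unfolding k_def by (rule add.idem_sandwich[OF e h])
  finally have "x = k \<odot> x"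
    using circ_inverse[OF S(3)] circ.mul_inver_mul[OF S(3)] add_clifford[OF S(3)] by metis
  also have "\<dots> = k \<odot> e \<oplus> k \<odot> c"
    unfolding x_def by (rule idem_circ_add_hom[OF k S(1) c])
  also have "k \<odot> e = e \<oplus> h"
    unfolding idem_circ_idem[OF k e] unfolding k_def by (rule add.idem_sandwich[OF e h])
  also have "k \<odot> c = e \<odot> c"
    using S c hc by (simp add: k_def idem_circ_idem[OF e h, symmetric] circ.assoc)
  also have "e \<oplus> h \<oplus> e \<odot> c = e \<odot> c"
    unfolding h_def by (rule idem_circ_absorb(1)[OF e c])
  finally show ?thesis by (simp add: x_def)
qed

section \<open>The maps \<open>\<rho>\<^sub>b\<close>\<close>

text \<open>
  The two sides expand to the same sum up to \<open>e \<oplus> c\<close> against \<open>e \<odot> c\<close> with the idempotent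
  \<open>e = b\<^sup>- \<odot> b\<close>.
\<close>

lemma inver_circ_add_circ:
  assumes S: "x \<in> S" "b \<in> S" "c \<in> S"
  shows "circ.inver b \<odot> (x \<oplus> b) \<oplus> c = circ.inver b \<odot> (x \<oplus> b \<odot> c)"
proof -
  let ?b = "circ.inver b"
  let ?u = "?b \<odot> x \<oplus> add.inver ?b"
  have e: "add.idem (?b \<odot> b)"
    using circ.idem_inver_mul[OF S(2)] by (simp add: idem_circ_iff_add)
  have "?b \<odot> (x \<oplus> b) \<oplus> c = ?u \<oplus> (?b \<odot> b \<oplus> c)"
    using S by (simp add: left_distrib add.assoc add.closed circ.closed)
  also have "?b \<odot> b \<oplus> c = ?b \<odot> (b \<odot> c)"
    using S by (simp add: idem_circ_eq_add[OF e, symmetric] circ.assoc)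
  also have "?u \<oplus> ?b \<odot> (b \<odot> c) = ?b \<odot> (x \<oplus> b \<odot> c)"
    using S by (simp add: left_distrib circ.closed)
  finally show ?thesis .
qed

lemma brace_rho_closed:
  "b \<in> S \<Longrightarrow> brace_rho S add circ b \<in> full_transformations S"
  by (simp add: brace_rho_def circ.closed add.closed)

lemma brace_rho_circ:
  assumes S: "b \<in> S" "c \<in> S"
  shows "brace_rho S add circ (b \<odot> c)
    = compose S (brace_rho S add circ c) (brace_rho S add circ b)"
proof
  fix a
  show "brace_rho S add circ (b \<odot> c) a
    = compose S (brace_rho S add circ c) (brace_rho S add circ b) a"
  proof (cases "a \<in> S")
    case True
    define x where "x = circ.inver a"
    have x: "x \<in> S" using True by (simp add: x_def)
    let ?r = "circ.inver (x \<oplus> b) \<odot> b"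
    have "circ.inver ?r = circ.inver b \<odot> (x \<oplus> b)"
      using S x by (simp add: circ.inver_mul circ.inver_inver add.closed)
    hence "circ.inver (circ.inver ?r \<oplus> c) \<odot> c
        = circ.inver (circ.inver b \<odot> (x \<oplus> b \<odot> c)) \<odot> c"
      using S x by (simp add: inver_circ_add_circ)
    also have "\<dots> = circ.inver (x \<oplus> b \<odot> c) \<odot> (b \<odot> c)"
      using S x by (simp add: circ.inver_mul circ.inver_inver add.closed circ.closed circ.assoc)
    finally show ?thesis
      using True S x
      by (simp add: brace_rho_def compose_def x_def[symmetric] circ.closed add.closed)
  qed (simp add: brace_rho_def compose_def)
qed

end

theorem proposition12:
  fixes S :: "'a set" and add circ :: "'a \<Rightarrow> 'a \<Rightarrow> 'a"
  assumes "weak_brace S add circ"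
  shows "semigroup_anti_hom S circ (full_transformations S) (compose S) (brace_rho S add circ)"
proof -
  interpret weak_brace S add circ by (rule assms)
  show ?thesis
  proof unfold_locales
    fix f g h :: "'a \<Rightarrow> 'a"
    assume fgh: "f \<in> full_transformations S" "g \<in> full_transformations S"
      "h \<in> full_transformations S"
    show "compose S f g \<in> full_transformations S"
      using fgh by (auto simp: compose_def)
    show "compose S (compose S f g) h = compose S f (compose S g h)"
      using fgh compose_assoc[of h S S f g] by (simp add: PiE_def)
  next
    show "brace_rho S add circ \<in> S \<rightarrow> full_transformations S"
      by (rule Pi_I) (rule brace_rho_closed)
  qed (rule brace_rho_circ)
qed

end
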